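(* Let $n,L,\kappa$ be positive integers and let $\omega$ be a primitive $m$-th root of unity. Let $B_m$ be the set of cycles $A$ of the Zolotarev graph $Z(n,L)$ whose length $|A|$ is divisible by $m$. Then the collection of functions $$\bigcup_{A\in B_m}\left\{F_{\omega,L,\kappa,n,r}\ \middle|\ r=\min(A)\right\}$$ is a basis for the vector space $E_n(\omega,L,\kappa)$.
   Context: $\mathcal{R}$ is the complex vector space of rational functions over $\mathbb{C}$ analytic at the origin, identified with their Taylor series; $U_n\left(\sum_{k\ge 0}a(k)x^k\right)=\sum_{k\ge 0}a(nk)x^k$. For positive integers $L,\kappa$, $$\mathcal{R}(L,\kappa)=\left\{f\in\mathcal{R}\mid f(x)=\sum_{k\ge0}k^{\kappa-1}a(k)x^k,\ a(k+L)=a(k)\text{ for all }k\ge 0\right\}$$ (with $0^0=1$), and $E_n(\omega,L,\kappa)=\{f\in\mathcal{R}(L,\kappa)\mid U_n f=n^{\kappa-1}\omega f\}$. The Zolotarev graph $Z(n,L)$ is the directed graph with node set $\mathbb{Z}/L\mathbb{Z}$ and an edge from $a$ to $b$ exactly when $na\equiv b\pmod L$. A root is a node $r$ with $n^k r\equiv r\pmod L$ for some integer $k\ge1$; the cycle containing $r$ is $\{r,nr,n^2r,\dots\}$ and its length is its cardinality. $\min(A)$ is the smallest element of $A$ when residues are represented by integers in $[0,L-1]$. For nodes $a,b$, $d(a,b)$ is the smallest integer $k\ge0$ with $n^k a\equiv b\pmod L$, if such $k$ exists; in that case $a$ is said to be path-connected to $b$. For a root $r$ lying in a cycle whose length is divisible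 by $m$, define $F_{\omega,L,\kappa,n,r}(x)=\sum_{k\ge0}k^{\kappa-1}a_{\omega,L,n,r}(k)x^k$, where $a_{\omega,L,n,r}(i)=\omega^{-d(i,r)}$ if (the class mod $L$ of) $i$ is path-connected to $r$, and $a_{\omega,L,n,r}(i)=0$ otherwise. *)

theory Defs
  imports "HOL-Complex_Analysis.Complex_Analysis" "HOL-Number_Theory.Cong" "Graph_Theory.Pair_Digraph"
begin

section \<open>Rational functions analytic at the origin\<close>

text \<open>
  There is no scalar multiplication by complex numbers among the type class operations on
  \<^typ>\<open>complex fps\<close>, so the vector space structure is given by a locale interpretation.
\<close>

interpretation fps_vs: vector_space "\<lambda>(c::complex) (f::complex fps). fps_const c * f"
  by unfold_locales (simp_all add: algebra_simps flip: fps_const_add fps_const_mult)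

definition basis_of :: "complex fps set \<Rightarrow> complex fps set \<Rightarrow> bool" where
  "basis_of B V \<longleftrightarrow>
     fps_vs.subspace V \<and> B \<subseteq> V \<and> fps_vs.independent B \<and> fps_vs.span B = V"

text \<open>
  A rational function is analytic at the origin iff it can be written with a denominator that
  does not vanish there; it is represented by its Taylor series.
\<close>

definition analytic_ratfuns :: "complex fps set" where
  "analytic_ratfuns =
     {f. \<exists>p q :: complex poly. poly q 0 \<noteq> 0 \<and> (\<lambda>x. poly p x / poly q x) has_fps_expansion f}"

definition U_op :: "nat \<Rightarrow> complex fps \<Rightarrow> complex fps" where
  "U_op n f = Abs_fps (\<lambda>k. fps_nth f (n * k))"

definition R_space :: "nat \<Rightarrow> nat \<Rightarrow> complex fps set" where
  "R_space L \<kappa> =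
     {f \<in> analytic_ratfuns. \<exists>a :: nat \<Rightarrow> complex.
        f = Abs_fps (\<lambda>k. of_nat k ^ (\<kappa> - 1) * a k) \<and> (\<forall>k. a (k + L) = a k)}"

definition E_space :: "nat \<Rightarrow> complex \<Rightarrow> nat \<Rightarrow> nat \<Rightarrow> complex fps set" where
  "E_space n \<omega> L \<kappa> =
     {f \<in> R_space L \<kappa>. U_op n f = fps_const (of_nat n ^ (\<kappa> - 1) * \<omega>) * f}"

definition primitive_root_of_unity :: "nat \<Rightarrow> complex \<Rightarrow> bool" where
  "primitive_root_of_unity m \<omega> \<longleftrightarrow>
     m \<ge> 1 \<and> \<omega> ^ m = 1 \<and> (\<forall>j. 1 \<le> j \<and> j < m \<longrightarrow> \<omega> ^ j \<noteq> 1)"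


section \<open>The Zolotarev graph\<close>

text \<open>
  Residue classes modulo \<open>L\<close> are represented by the natural numbers below \<open>L\<close>. The predicates
  \<open>path_connected_to\<close> and \<open>path_dist\<close> only depend on the classes of their arguments, so they can
  be applied to arbitrary natural numbers.
\<close>

definition zolotarev_graph :: "nat \<Rightarrow> nat \<Rightarrow> nat pair_pre_digraph" where
  "zolotarev_graph n L =
     \<lparr> pverts = {..<L}, parcs = {(a, b). a < L \<and> b < L \<and> [n * a = b] (mod L)} \<rparr>"

definition is_root :: "nat \<Rightarrow> nat \<Rightarrow> nat \<Rightarrow> bool" where
  "is_root n L r \<longleftrightarrow>
     r \<in> pverts (zolotarev_graph n L) \<and> (\<exists>k\<ge>1. [n ^ k * r = r] (mod L))"

definition cycle_of :: "nat \<Rightarrow> nat \<Rightarrow> nat \<Rightarrow> nat set" where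
  "cycle_of n L r = {(n ^ k * r) mod L | k. True}"

definition zolotarev_cycles :: "nat \<Rightarrow> nat \<Rightarrow> nat set set" where
  "zolotarev_cycles n L = {cycle_of n L r | r. is_root n L r}"

definition path_connected_to :: "nat \<Rightarrow> nat \<Rightarrow> nat \<Rightarrow> nat \<Rightarrow> bool" where
  "path_connected_to n L a b \<longleftrightarrow> (\<exists>k. [n ^ k * a = b] (mod L))"

definition path_dist :: "nat \<Rightarrow> nat \<Rightarrow> nat \<Rightarrow> nat \<Rightarrow> nat" where
  "path_dist n L a b = (LEAST k. [n ^ k * a = b] (mod L))"

definition a_coeff :: "complex \<Rightarrow> nat \<Rightarrow> nat \<Rightarrow> nat \<Rightarrow> nat \<Rightarrow> complex" where
  "a_coeff \<omega> L n r i =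
     (if path_connected_to n L i r then \<omega> powi (- int (path_dist n L i r)) else 0)"

definition F_fun :: "complex \<Rightarrow> nat \<Rightarrow> nat \<Rightarrow> nat \<Rightarrow> nat \<Rightarrow> complex fps" where
  "F_fun \<omega> L \<kappa> n r = Abs_fps (\<lambda>k. of_nat k ^ (\<kappa> - 1) * a_coeff \<omega> L n r k)"

definition B_cycles :: "nat \<Rightarrow> nat \<Rightarrow> nat \<Rightarrow> nat set set" where
  "B_cycles m n L = {A \<in> zolotarev_cycles n L. m dvd card A}"


section \<open>Consistency checks\<close>

lemma analytic_ratfuns_altdef:
  "analytic_ratfuns =
     {fps_of_poly p / fps_of_poly q | p q :: complex poly. poly q 0 \<noteq> 0}"
proof -
  have expn: "(\<lambda>x. poly p x / poly q x) has_fps_expansion (fps_of_poly p / fps_of_poly q)"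
    if "poly q 0 \<noteq> 0" for p q :: "complex poly"
  proof (rule has_fps_expansion_divide')
    have "(\<lambda>x. poly r x) has_fps_expansion fps_of_poly r" for r :: "complex poly"
    proof (induction r)
      case (pCons c r)
      have "(\<lambda>x. c + x * poly r x) has_fps_expansion (fps_const c + fps_X * fps_of_poly r)"
        by (intro fps_expansion_intros pCons)
      then show ?case
        by (simp add: fps_of_poly_pCons algebra_simps)
    qed simp
    then show "poly p has_fps_expansion fps_of_poly p" "poly q has_fps_expansion fps_of_poly q"
      by simp_all
    show "fps_nth (fps_of_poly q) 0 \<noteq> 0"
      using that by (simp add: poly_0_coeff_0)
  qed
  show ?thesis
    unfolding analytic_ratfuns_def
    by (auto intro: expn) (metis expn fps_expansion_unique_complex)
qed

lemma zolotarev_graph_wf: "pair_wf_digraph (zolotarev_graph n L)"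
  by unfold_locales (auto simp: zolotarev_graph_def)

lemma zolotarev_graph_relpow:
  assumes "a < L" "b < L"
  shows "(a, b) \<in> parcs (zolotarev_graph n L) ^^ k \<longleftrightarrow> [n ^ k * a = b] (mod L)"
  using assms(2)
proof (induction k arbitrary: b)
  case 0
  then show ?case using assms(1) by (auto simp: cong_def)
next
  case (Suc k)
  have "(a, b) \<in> parcs (zolotarev_graph n L) ^^ Suc k \<longleftrightarrow>
        (\<exists>c<L. [n ^ k * a = c] (mod L) \<and> [n * c = b] (mod L))"
    using Suc by (auto simp: zolotarev_graph_def)
  also have "\<dots> \<longleftrightarrow> [n * (n ^ k * a) = b] (mod L)"
  proof
    assume "\<exists>c<L. [n ^ k * a = c] (mod L) \<and> [n * c = b] (mod L)"
    then show "[n * (n ^ k * a) = b] (mod L)"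
      by (meson cong_scalar_left cong_trans)
  next
    assume *: "[n * (n ^ k * a) = b] (mod L)"
    show "\<exists>c<L. [n ^ k * a = c] (mod L) \<and> [n * c = b] (mod L)"
      by (rule exI[of _ "(n ^ k * a) mod L"])
        (use * Suc.prems in \<open>auto simp: cong_def mod_mult_right_eq\<close>)
  qed
  finally show ?case by (simp add: mult.assoc)
qed

lemma path_connected_to_iff_rtrancl:
  assumes "a < L" "b < L"
  shows "path_connected_to n L a b \<longleftrightarrow> (a, b) \<in> (parcs (zolotarev_graph n L))\<^sup>*"
  using zolotarev_graph_relpow[OF assms]
  by (auto simp: path_connected_to_def rtrancl_power)

lemma is_root_iff_trancl:
  "is_root n L r \<longleftrightarrow> (r, r) \<in> (parcs (zolotarev_graph n L))\<^sup>+"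
proof (cases "r < L")
  case True
  then show ?thesis
    using zolotarev_graph_relpow[OF True True, where n = n]
    by (simp add: is_root_def trancl_power Suc_le_eq) (simp add: zolotarev_graph_def)
next
  case False
  have "(r, r) \<notin> (parcs (zolotarev_graph n L))\<^sup>+"
  proof
    assume "(r, r) \<in> (parcs (zolotarev_graph n L))\<^sup>+"
    then obtain b where "(r, b) \<in> parcs (zolotarev_graph n L)"
      by (meson tranclD)
    with False show False by (auto simp: zolotarev_graph_def)
  qed
  with False show ?thesis by (auto simp: is_root_def zolotarev_graph_def)
qed

lemma subspace_analytic_ratfuns: "fps_vs.subspace analytic_ratfuns"
proof (rule fps_vs.subspaceI)
  have "(\<lambda>x::complex. poly 0 x / poly 1 x) has_fps_expansion 0"
    by simp
  then show "0 \<in> analytic_ratfuns"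
    unfolding analytic_ratfuns_def mem_Collect_eq by (intro exI[of _ 0] exI[of _ 1]) simp
next
  fix f g assume "f \<in> analytic_ratfuns" "g \<in> analytic_ratfuns"
  then obtain p q p' q' where *:
    "f = fps_of_poly p / fps_of_poly q" "poly q 0 \<noteq> 0"
    "g = fps_of_poly p' / fps_of_poly q'" "poly q' 0 \<noteq> 0"
    unfolding analytic_ratfuns_altdef by blast
  then have nz: "fps_nth (fps_of_poly q) 0 \<noteq> 0" "fps_nth (fps_of_poly q') 0 \<noteq> 0"
    by (simp_all add: poly_0_coeff_0)
  have nz': "fps_nth (fps_of_poly (q * q')) 0 \<noteq> 0"
    using nz by (simp add: fps_of_poly_mult)
  have inv: "inverse (fps_of_poly q) * fps_of_poly q = 1"
    "inverse (fps_of_poly q') * fps_of_poly q' = 1"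
    using nz by (simp_all add: inverse_mult_eq_1)
  have "f + g = (fps_of_poly p * inverse (fps_of_poly q)) * (inverse (fps_of_poly q') * fps_of_poly q')
     + (fps_of_poly p' * inverse (fps_of_poly q')) * (inverse (fps_of_poly q) * fps_of_poly q)"
    unfolding inv using * nz by (simp add: fps_divide_unit)
  also have "\<dots> = fps_of_poly (p * q' + p' * q) * inverse (fps_of_poly (q * q'))"
    by (simp add: fps_of_poly_mult fps_of_poly_add fps_inverse_mult algebra_simps)
  also have "\<dots> = fps_of_poly (p * q' + p' * q) / fps_of_poly (q * q')"
    using nz' by (simp add: fps_divide_unit)
  finally show "f + g \<in> analytic_ratfuns"
    unfolding analytic_ratfuns_altdef using *(2,4)
    by (intro CollectI exI[of _ "p * q' + p' * q"] exI[of _ "q * q'"]) simp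
next
  fix c f assume "f \<in> analytic_ratfuns"
  then obtain p q where *: "f = fps_of_poly p / fps_of_poly q" "poly q 0 \<noteq> 0"
    unfolding analytic_ratfuns_altdef by blast
  then have nz: "fps_nth (fps_of_poly q) 0 \<noteq> 0"
    by (simp add: poly_0_coeff_0)
  have "fps_const c * f = fps_of_poly (smult c p) / fps_of_poly q"
    using * nz by (simp add: fps_divide_unit fps_of_poly_smult mult.assoc)
  then show "fps_const c * f \<in> analytic_ratfuns"
    unfolding analytic_ratfuns_altdef using *(2) by blast
qed

end

theory Submission
  imports Defs
begin

text \<open>
  A function in $E_n(\omega,L,\kappa)$ is the weighted series of a sequence \<open>a\<close> that is periodic
  modulo \<open>L\<close> and satisfies \<open>a (n k) = \<omega> a k\<close> (\<open>E_space_eq\<close>); conversely all these series are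
  rational, since a periodic series has denominator \<open>1 - x\<^sup>L\<close> and each factor \<open>k\<close> comes from
  the operator \<open>x d/dx\<close>. The theorem is therefore about functions on the nodes of the Zolotarev
  graph that get multiplied by \<open>\<omega>\<close> along every edge.

  Such a function is governed by its values on the cycles. Every node \<open>i\<close> leads into exactly one
  cycle, hence to exactly one cycle minimum \<open>r\<close>, and walking from \<open>i\<close> to \<open>r\<close> forces
  \<open>a i = \<omega>\<^sup>-\<^sup>d a r\<close>, where \<open>d\<close> is the length of the walk. Walking once around the cycle of \<open>r\<close>,
  of length \<open>l\<close>, forces \<open>a r = \<omega>\<^sup>l a r\<close>, so \<open>a r = 0\<close> unless \<open>m\<close> divides \<open>l\<close>. Thus \<open>a\<close> is
  the combination of the coefficient sequences of the \<open>F_fun\<close> in which the one belonging to \<open>r\<close>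
  has coefficient \<open>a r\<close> (\<open>eigen_seq_expansion\<close>), which gives spanning.

  In the other direction, \<open>m\<close> dividing \<open>l\<close> is what makes the coefficient sequence of \<open>r\<close> an
  eigensequence: along an edge between nodes that lead to \<open>r\<close> the distance to \<open>r\<close> drops by one, except on the edge leaving \<open>r\<close>,
  where it jumps from \<open>0\<close> to \<open>l - 1\<close> (\<open>a_coeff_in_eigen_seqs\<close>). Finally the sequence of
  \<open>r\<close> is \<open>1\<close> at \<open>r\<close> and \<open>0\<close> at all other cycle minima (\<open>a_coeff_at_minima\<close>), so the
  functions are linearly independent.
\<close>

section \<open>Rationality of weighted periodic series\<close>

text \<open>
  With cleared denominators, membership is shown by ring identities rather than by division of
  power series.
\<close>

lemma analytic_ratfuns_iff:
  "f \<in> analytic_ratfuns \<longleftrightarrow>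
     (\<exists>p q :: complex poly. poly q 0 \<noteq> 0 \<and> f * fps_of_poly q = fps_of_poly p)"
proof -
  have "f = fps_of_poly p / fps_of_poly q \<longleftrightarrow> f * fps_of_poly q = fps_of_poly p"
    if "poly q 0 \<noteq> 0" for p q :: "complex poly"
  proof -
    have nz: "fps_nth (fps_of_poly q) 0 \<noteq> 0"
      using that by (simp add: poly_0_coeff_0)
    then have inv: "inverse (fps_of_poly q) * fps_of_poly q = 1"
      by (rule inverse_mult_eq_1)
    have "fps_of_poly p / fps_of_poly q = fps_of_poly p * inverse (fps_of_poly q)"
      using nz by (rule fps_divide_unit)
    moreover have "(f * fps_of_poly q) * inverse (fps_of_poly q) = f"
      using inv by (simp add: mult.assoc mult.commute[of "fps_of_poly q"])
    moreover have "(fps_of_poly p * inverse (fps_of_poly q)) * fps_of_poly q = fps_of_poly p"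
      using inv by (simp add: mult.assoc)
    ultimately show ?thesis
      by (intro iffI) (simp_all only:)
  qed
  then show ?thesis
    unfolding analytic_ratfuns_altdef by blast
qed

text \<open>
  The operator \<open>x d/dx\<close> multiplies the \<open>k\<close>-th coefficient by \<open>k\<close>. The quotient rule gives
  the denominator \<open>q\<^sup>2\<close>.
\<close>

lemma analytic_ratfuns_X_deriv:
  assumes "f \<in> analytic_ratfuns"
  shows "fps_X * fps_deriv f \<in> analytic_ratfuns"
proof -
  obtain p q :: "complex poly" where q: "poly q 0 \<noteq> 0" and fq: "f * fps_of_poly q = fps_of_poly p"
    using assms by (auto simp: analytic_ratfuns_iff)
  let ?P = "fps_of_poly p" and ?Q = "fps_of_poly q"
  have "fps_deriv (f * ?Q) = fps_deriv ?P"
    by (simp add: fq)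
  then have d: "fps_deriv f * ?Q = fps_deriv ?P - f * fps_deriv ?Q"
    by (simp add: algebra_simps)
  have "fps_X * fps_deriv f * (?Q * ?Q) = fps_X * (fps_deriv f * ?Q) * ?Q"
    by (simp add: mult_ac)
  also have "\<dots> = fps_X * (fps_deriv ?P * ?Q - (f * ?Q) * fps_deriv ?Q)"
    unfolding d by (simp add: algebra_simps)
  also have "\<dots> = fps_of_poly ([:0, 1:] * (pderiv p * q - p * pderiv q))"
    by (simp add: fq fps_of_poly_mult fps_of_poly_diff fps_of_poly_pderiv fps_of_poly_pCons)
  finally have "fps_X * fps_deriv f * fps_of_poly (q * q) =
      fps_of_poly ([:0, 1:] * (pderiv p * q - p * pderiv q))"
    by (simp only: fps_of_poly_mult)
  moreover have "poly (q * q) 0 \<noteq> 0"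
    using q by simp
  ultimately show ?thesis
    unfolding analytic_ratfuns_iff by blast
qed

text \<open>
  Multiplying by \<open>1 - x\<^sup>L\<close> subtracts the series shifted by one period, which leaves only the
  coefficients of the first period.
\<close>

lemma periodic_series_ratfun:
  assumes "L \<ge> 1" and per: "\<And>k. a (k + L) = (a k :: complex)"
  shows "Abs_fps a \<in> analytic_ratfuns"
proof -
  have "Abs_fps a * fps_of_poly (1 - monom 1 L) = fps_of_poly (\<Sum>k<L. monom (a k) k)"
  proof (rule fps_ext)
    fix k
    have "fps_nth (Abs_fps a * fps_of_poly (1 - monom 1 L)) k =
        fps_nth (Abs_fps a - Abs_fps a * fps_X ^ L) k"
      by (simp add: fps_of_poly_diff fps_of_poly_monom right_diff_distrib)
    also have "\<dots> = a k - (if k < L then 0 else a (k - L))"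
      by (simp add: fps_X_power_mult_right_nth)
    also have "\<dots> = (if k < L then a k else 0)"
      using per[of "k - L"] by (cases "k < L") simp_all
    also have "\<dots> = coeff (\<Sum>i<L. monom (a i) i) k"
      by (simp add: coeff_sum)
    finally show "fps_nth (Abs_fps a * fps_of_poly (1 - monom 1 L)) k =
        fps_nth (fps_of_poly (\<Sum>k<L. monom (a k) k)) k"
      by simp
  qed
  moreover have "poly (1 - monom 1 L :: complex poly) 0 \<noteq> 0"
    using \<open>L \<ge> 1\<close> by (simp add: poly_monom power_0_left)
  ultimately show ?thesis
    unfolding analytic_ratfuns_iff by blast
qed

definition weighted_series :: "nat \<Rightarrow> (nat \<Rightarrow> complex) \<Rightarrow> complex fps" where
  "weighted_series \<kappa> a = Abs_fps (\<lambda>k. of_nat k ^ (\<kappa> - 1) * a k)"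

lemma weighted_series_nth [simp]: "fps_nth (weighted_series \<kappa> a) k = of_nat k ^ (\<kappa> - 1) * a k"
  by (simp add: weighted_series_def)

lemma weighted_periodic_series_ratfun:
  assumes "L \<ge> 1" and "\<And>k. a (k + L) = a k"
  shows "weighted_series \<kappa> a \<in> analytic_ratfuns"
proof -
  have "Abs_fps (\<lambda>k. of_nat k ^ j * a k) \<in> analytic_ratfuns" for j
  proof (induction j)
    case 0
    then show ?case
      using periodic_series_ratfun[of L a] assms by simp
  next
    case (Suc j)
    have "Abs_fps (\<lambda>k. of_nat k ^ Suc j * a k) =
        fps_X * fps_deriv (Abs_fps (\<lambda>k. of_nat k ^ j * a k))"
      by (rule fps_ext) (simp add: fps_X_mult_nth)
    then show ?case
      using analytic_ratfuns_X_deriv[OF Suc] by simp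
  qed
  then show ?thesis
    by (simp add: weighted_series_def)
qed


section \<open>Eigenfunctions as sequences\<close>

text \<open>
  Functions on the nodes of the Zolotarev graph, seen as \<open>L\<close>-periodic sequences, that are
  multiplied by \<open>\<omega>\<close> along each edge.
\<close>

definition eigen_seqs :: "nat \<Rightarrow> complex \<Rightarrow> nat \<Rightarrow> (nat \<Rightarrow> complex) set" where
  "eigen_seqs n \<omega> L = {a. (\<forall>k. a (k + L) = a k) \<and> (\<forall>k. a (n * k) = \<omega> * a k)}"

lemma periodic_cong:
  fixes a :: "nat \<Rightarrow> 'a"
  assumes "\<And>k. a (k + L) = a k" and "[i = j] (mod L)"
  shows "a i = a j"
proof -
  have mult: "a (k + t * L) = a k" for k t
    by (induction t) (simp_all add: assms(1) add.assoc[symmetric] add.commute[of L])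
  have "a k = a (k mod L)" for k
    using mult[of "k mod L" "k div L"] by simp
  then show ?thesis
    using assms(2) by (metis cong_def)
qed

text \<open>
  The eigenvalue equation for \<open>f\<close> compares \<open>a (n k)\<close> with \<open>\<omega> a k\<close> after both have been
  multiplied by \<open>(n k)\<^sup>\<kappa>\<^sup>-\<^sup>1\<close>. This factor vanishes at \<open>k = 0\<close> if \<open>\<kappa> > 1\<close>, but there the
  relation follows from the one at \<open>L\<close> by periodicity.
\<close>

lemma E_space_eq:
  assumes "n \<ge> 1" and "L \<ge> 1"
  shows "E_space n \<omega> L \<kappa> = weighted_series \<kappa> ` eigen_seqs n \<omega> L"
proof (intro equalityI subsetI)
  fix f assume "f \<in> E_space n \<omega> L \<kappa>"
  then obtain a where f: "f = weighted_series \<kappa> a" and per: "\<And>k. a (k + L) = a k"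
    and U: "U_op n f = fps_const (of_nat n ^ (\<kappa> - 1) * \<omega>) * f"
    by (auto simp: E_space_def R_space_def weighted_series_def)
  have pos: "a (n * k) = \<omega> * a k" if "k > 0" for k
  proof -
    have "fps_nth (U_op n f) k = fps_nth (fps_const (of_nat n ^ (\<kappa> - 1) * \<omega>) * f) k"
      by (simp add: U)
    then have "(of_nat n * of_nat k) ^ (\<kappa> - 1) * a (n * k) =
        (of_nat n * of_nat k) ^ (\<kappa> - 1) * (\<omega> * a k)"
      by (simp add: U_op_def f power_mult_distrib mult_ac)
    then show ?thesis
      using that assms by simp
  qed
  \<comment> \<open>Shifting by \<open>L\<close> makes the index positive without changing its class.\<close>
  have "a (n * k) = \<omega> * a k" for k
  proof -
    have "a (n * k) = a (n * (k + L))"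
      by (rule periodic_cong[where L = L and a = a]) (simp_all add: per cong_def distrib_left)
    also have "\<dots> = \<omega> * a k"
      using pos[of "k + L"] assms per by simp
    finally show ?thesis .
  qed
  then show "f \<in> weighted_series \<kappa> ` eigen_seqs n \<omega> L"
    using f per by (auto simp: eigen_seqs_def)
next
  fix f assume "f \<in> weighted_series \<kappa> ` eigen_seqs n \<omega> L"
  then obtain a where f: "f = weighted_series \<kappa> a" and per: "\<And>k. a (k + L) = a k"
    and mul: "\<And>k. a (n * k) = \<omega> * a k"
    by (auto simp: eigen_seqs_def)
  have "U_op n f = fps_const (of_nat n ^ (\<kappa> - 1) * \<omega>) * f"
    by (rule fps_ext) (simp add: U_op_def f mul power_mult_distrib)
  moreover have "f \<in> R_space L \<kappa>"
    using weighted_periodic_series_ratfun[of L a \<kappa>] assms per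
    by (auto simp: R_space_def f weighted_series_def)
  ultimately show "f \<in> E_space n \<omega> L \<kappa>"
    by (simp add: E_space_def)
qed

lemma subspace_E_space:
  assumes "n \<ge> 1" and "L \<ge> 1"
  shows "fps_vs.subspace (E_space n \<omega> L \<kappa>)"
  unfolding E_space_eq[OF assms]
proof (rule fps_vs.subspaceI)
  have "0 = weighted_series \<kappa> (\<lambda>_. 0)"
    by (rule fps_ext) simp
  then show "0 \<in> weighted_series \<kappa> ` eigen_seqs n \<omega> L"
    by (auto simp: eigen_seqs_def)
next
  fix f g assume "f \<in> weighted_series \<kappa> ` eigen_seqs n \<omega> L" "g \<in> weighted_series \<kappa> ` eigen_seqs n \<omega> L"
  then obtain a b where a: "a \<in> eigen_seqs n \<omega> L" "f = weighted_series \<kappa> a"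
    and b: "b \<in> eigen_seqs n \<omega> L" "g = weighted_series \<kappa> b"
    by blast
  have "f + g = weighted_series \<kappa> (\<lambda>k. a k + b k)"
    by (rule fps_ext) (simp add: a b algebra_simps)
  moreover have "(\<lambda>k. a k + b k) \<in> eigen_seqs n \<omega> L"
    using a b by (simp add: eigen_seqs_def algebra_simps)
  ultimately show "f + g \<in> weighted_series \<kappa> ` eigen_seqs n \<omega> L"
    by blast
next
  fix c f assume "f \<in> weighted_series \<kappa> ` eigen_seqs n \<omega> L"
  then obtain a where a: "a \<in> eigen_seqs n \<omega> L" "f = weighted_series \<kappa> a"
    by blast
  have "fps_const c * f = weighted_series \<kappa> (\<lambda>k. c * a k)"
    by (rule fps_ext) (simp add: a algebra_simps)
  moreover have "(\<lambda>k. c * a k) \<in> eigen_seqs n \<omega> L"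
    using a by (simp add: eigen_seqs_def algebra_simps)
  ultimately show "fps_const c * f \<in> weighted_series \<kappa> ` eigen_seqs n \<omega> L"
    by blast
qed

lemma eigen_seq_along_path:
  assumes "a \<in> eigen_seqs n \<omega> L" and "[n ^ k * i = j] (mod L)"
  shows "a j = \<omega> ^ k * a i"
proof -
  have mul: "a (n * x) = \<omega> * a x" for x
    using assms(1) by (simp add: eigen_seqs_def)
  have "a (n ^ k * i) = \<omega> ^ k * a i"
    by (induction k) (simp_all add: mul mult.assoc)
  moreover have "a (n ^ k * i) = a j"
  proof (rule periodic_cong)
    show "a (x + L) = a x" for x
      using assms(1) by (simp add: eigen_seqs_def)
  qed (fact assms(2))
  ultimately show ?thesis
    by simp
qed


section \<open>Cycles of the Zolotarev graph\<close>

text \<open>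
  A walk of \<open>k\<close> steps from \<open>a\<close> to \<open>b\<close> is the congruence \<open>[n ^ k * a = b] (mod L)\<close>. Every
  node has a single outgoing edge, so walks can be concatenated and an initial part of a walk can
  be cut off.
\<close>

lemma path_trans:
  fixes n :: nat
  assumes "[n ^ s * a = b] (mod L)" and "[n ^ t * b = c] (mod L)"
  shows "[n ^ (t + s) * a = c] (mod L)"
proof -
  have "[n ^ t * (n ^ s * a) = n ^ t * b] (mod L)"
    using assms(1) by (rule cong_scalar_left)
  then show ?thesis
    using cong_trans[OF _ assms(2)] by (simp add: power_add mult.assoc)
qed

lemma path_cancel:
  fixes n :: nat
  assumes "[n ^ s * a = b] (mod L)" and "[n ^ (s + t) * a = c] (mod L)"
  shows "[n ^ t * b = c] (mod L)"
proof -
  have "[n ^ t * b = n ^ t * (n ^ s * a)] (mod L)"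
    by (rule cong_scalar_left[OF cong_sym[OF assms(1)]])
  moreover have "n ^ t * (n ^ s * a) = n ^ (s + t) * a"
    by (simp add: power_add mult_ac)
  ultimately show ?thesis
    using cong_trans[OF _ assms(2)] by simp
qed

lemma mem_cycle_of_iff:
  "x \<in> cycle_of n L r \<longleftrightarrow> x mod L = x \<and> (\<exists>k. [n ^ k * r = x] (mod L))"
proof
  assume "x \<in> cycle_of n L r"
  then show "x mod L = x \<and> (\<exists>k. [n ^ k * r = x] (mod L))"
    by (auto simp: cycle_of_def cong_def)
next
  assume "x mod L = x \<and> (\<exists>k. [n ^ k * r = x] (mod L))"
  then obtain k where "x mod L = x" "[n ^ k * r = x] (mod L)"
    by blast
  then have "x = (n ^ k * r) mod L"
    by (simp add: cong_def)
  then show "x \<in> cycle_of n L r"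
    unfolding cycle_of_def by blast
qed

lemma is_root_iff: "is_root n L r \<longleftrightarrow> r < L \<and> (\<exists>k\<ge>1. [n ^ k * r = r] (mod L))"
  by (simp add: is_root_def zolotarev_graph_def)

lemma root_self_mem: "is_root n L r \<Longrightarrow> r \<in> cycle_of n L r"
  unfolding mem_cycle_of_iff is_root_iff by auto

lemma path_mult:
  fixes n :: nat
  assumes "[n ^ l * r = r] (mod L)"
  shows "[n ^ (t * l) * r = r] (mod L)"
proof (induction t)
  case (Suc t)
  show ?case
    using path_trans[OF Suc assms] by simp
qed simp

text \<open>
  What a root reaches lies on its cycle: \<open>s\<close> full turns have at least \<open>s\<close> steps, and what is
  left of them after the first \<open>s\<close> steps leads from \<open>x\<close> back to \<open>r\<close>.
\<close>

lemma root_path_back: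
  assumes "is_root n L r" and "[n ^ s * r = x] (mod L)"
  shows "\<exists>t. [n ^ t * x = r] (mod L)"
proof -
  obtain l where l: "l \<ge> 1" "[n ^ l * r = r] (mod L)"
    using assms(1) by (auto simp: is_root_iff)
  have "s \<le> s * l"
    using l(1) by simp
  then have "[n ^ (s + (s * l - s)) * r = r] (mod L)"
    using path_mult[OF l(2), of s] by simp
  then show ?thesis
    using path_cancel[OF assms(2)] by blast
qed

lemma root_in_cycle:
  assumes "is_root n L r" and "x \<in> cycle_of n L r"
  shows "is_root n L x" and "cycle_of n L x = cycle_of n L r"
proof -
  obtain s where s: "[n ^ s * r = x] (mod L)" and xL: "x mod L = x"
    using assms(2) by (auto simp: mem_cycle_of_iff)
  obtain t where t: "[n ^ t * x = r] (mod L)"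
    using root_path_back[OF assms(1) s] by blast
  obtain l where l: "l \<ge> 1" "[n ^ l * r = r] (mod L)"
    using assms(1) by (auto simp: is_root_iff)
  have "[n ^ (s + (l + t)) * x = x] (mod L)"
    using path_trans[OF path_trans[OF t l(2)] s] .
  moreover have "x < L"
    using xL assms(1) by (metis is_root_iff mod_less_divisor gr_zeroI not_less_zero)
  ultimately show "is_root n L x"
    unfolding is_root_iff using l(1) by (intro conjI exI[of _ "s + (l + t)"]) auto
  have "(\<exists>k. [n ^ k * x = y] (mod L)) \<longleftrightarrow> (\<exists>k. [n ^ k * r = y] (mod L))" for y
    using path_trans[OF s, of _ y] path_trans[OF t, of _ y] by blast
  then show "cycle_of n L x = cycle_of n L r"
    by (simp add: set_eq_iff mem_cycle_of_iff)
qed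

text \<open>
  The length of a cycle, defined as a cardinality, is the first return time \<open>l\<close> of each of its
  nodes: steps can be reduced modulo \<open>l\<close>, and a coincidence of the \<open>i\<close>-th and the \<open>j\<close>-th node
  with \<open>i < j < l\<close> would allow a return after \<open>l - j + i < l\<close> steps.
\<close>

lemma card_cycle_return_time:
  assumes "is_root n L r"
  shows "card (cycle_of n L r) \<ge> 1" and "[n ^ card (cycle_of n L r) * r = r] (mod L)"
    and "\<And>k. k \<ge> 1 \<Longrightarrow> [n ^ k * r = r] (mod L) \<Longrightarrow> card (cycle_of n L r) \<le> k"
proof -
  define l where "l = (LEAST k. k \<ge> 1 \<and> [n ^ k * r = r] (mod L))"
  have ex: "\<exists>k. k \<ge> 1 \<and> [n ^ k * r = r] (mod L)"
    using assms by (auto simp: is_root_iff)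
  have l: "l \<ge> 1" "[n ^ l * r = r] (mod L)"
    using LeastI_ex[OF ex] by (simp_all add: l_def)
  have least: "l \<le> k" if "k \<ge> 1" "[n ^ k * r = r] (mod L)" for k
    unfolding l_def using that by (intro Least_le) simp
  have "cycle_of n L r = (\<lambda>k. (n ^ k * r) mod L) ` {..<l}"
  proof (intro equalityI subsetI)
    fix x assume "x \<in> cycle_of n L r"
    then obtain k where x: "x = (n ^ k * r) mod L"
      by (auto simp: cycle_of_def)
    have "[n ^ (k mod l + k div l * l) * r = n ^ (k mod l) * r] (mod L)"
      by (rule path_trans[OF path_mult[OF l(2)]]) simp
    then have "x = (n ^ (k mod l) * r) mod L"
      by (simp add: x cong_def)
    then show "x \<in> (\<lambda>k. (n ^ k * r) mod L) ` {..<l}"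
      using l(1) by auto
  qed (auto simp: cycle_of_def)
  moreover have "inj_on (\<lambda>k. (n ^ k * r) mod L) {..<l}"
  proof (rule linorder_inj_onI')
    fix i j assume ij: "i \<in> {..<l}" "j \<in> {..<l}" "i < j"
    show "(n ^ i * r) mod L \<noteq> (n ^ j * r) mod L"
    proof
      assume eq: "(n ^ i * r) mod L = (n ^ j * r) mod L"
      have "[n ^ (j + (l - j)) * r = r] (mod L)"
        using l(2) ij by simp
      then have "[n ^ (l - j) * (n ^ j * r) = r] (mod L)"
        using path_cancel[of n j r "n ^ j * r" L "l - j" r] by simp
      moreover have "[n ^ i * r = n ^ j * r] (mod L)"
        using eq by (simp add: cong_def)
      ultimately have "[n ^ (l - j + i) * r = r] (mod L)"
        using path_trans by blast
      then have "l \<le> l - j + i"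
        using ij by (intro least) auto
      then show False
        using ij by simp
    qed
  qed
  ultimately have "card (cycle_of n L r) = l"
    by (simp add: card_image)
  with l least show "card (cycle_of n L r) \<ge> 1" "[n ^ card (cycle_of n L r) * r = r] (mod L)"
    and "\<And>k. k \<ge> 1 \<Longrightarrow> [n ^ k * r = r] (mod L) \<Longrightarrow> card (cycle_of n L r) \<le> k"
    by simp_all
qed

text \<open>
  Each cycle is represented by its smallest node, so that statements about cycles become
  statements about nodes.
\<close>

definition cycle_minima :: "nat \<Rightarrow> nat \<Rightarrow> nat set" where
  "cycle_minima n L = {r. is_root n L r \<and> r = Min (cycle_of n L r)}"

lemma finite_cycle_of: "L \<ge> 1 \<Longrightarrow> finite (cycle_of n L r)"
  by (rule finite_subset[of _ "{..<L}"]) (auto simp: cycle_of_def)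

lemma Min_cycle_of:
  assumes "is_root n L r"
  shows "Min (cycle_of n L r) \<in> cycle_of n L r" "Min (cycle_of n L r) \<in> cycle_minima n L"
    "cycle_of n L (Min (cycle_of n L r)) = cycle_of n L r"
proof -
  show mem: "Min (cycle_of n L r) \<in> cycle_of n L r"
    using root_self_mem[OF assms] assms by (intro Min_in finite_cycle_of) (auto simp: is_root_iff)
  show "cycle_of n L (Min (cycle_of n L r)) = cycle_of n L r"
    using root_in_cycle[OF assms mem] by simp
  then show "Min (cycle_of n L r) \<in> cycle_minima n L"
    using root_in_cycle[OF assms mem] by (simp add: cycle_minima_def)
qed

lemma Min_B_cycles:
  "Min ` B_cycles m n L = {r \<in> cycle_minima n L. m dvd card (cycle_of n L r)}"
proof (intro equalityI subsetI)
  fix x assume "x \<in> Min ` B_cycles m n L"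
  then obtain r where "is_root n L r" "m dvd card (cycle_of n L r)" "x = Min (cycle_of n L r)"
    by (auto simp: B_cycles_def zolotarev_cycles_def)
  then show "x \<in> {r \<in> cycle_minima n L. m dvd card (cycle_of n L r)}"
    using Min_cycle_of by simp
next
  fix r assume "r \<in> {r \<in> cycle_minima n L. m dvd card (cycle_of n L r)}"
  then show "r \<in> Min ` B_cycles m n L"
    by (auto simp: B_cycles_def zolotarev_cycles_def cycle_minima_def intro!: image_eqI[of _ Min])
qed

text \<open>
  By the pigeonhole principle the walk from \<open>i\<close> repeats a node. The repeated node is a root, and
  going around its cycle reaches the minimum.
\<close>

lemma path_to_cycle_minimum:
  assumes "L \<ge> 1"
  shows "\<exists>r \<in> cycle_minima n L. path_connected_to n L i r"
proof -
  have "\<not> inj_on (\<lambda>k. (n ^ k * i) mod L) UNIV"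
  proof
    assume "inj_on (\<lambda>k. (n ^ k * i) mod L) UNIV"
    moreover have "finite (range (\<lambda>k. (n ^ k * i) mod L))"
      by (rule finite_subset[of _ "{..<L}"]) (use assms in auto)
    ultimately show False
      using finite_imageD by blast
  qed
  then obtain s t where st: "s < t" "(n ^ s * i) mod L = (n ^ t * i) mod L"
    unfolding inj_on_def by (metis linorder_neqE_nat)
  let ?r = "(n ^ s * i) mod L"
  have ir: "[n ^ s * i = ?r] (mod L)"
    by (simp add: cong_def)
  have "[n ^ (s + (t - s)) * i = ?r] (mod L)"
    using st by (simp add: cong_def)
  from path_cancel[OF ir this] have "is_root n L ?r"
    unfolding is_root_iff using st assms by (intro conjI exI[of _ "t - s"]) auto
  note min = Min_cycle_of[OF this]
  from min(1) obtain u where "[n ^ u * ?r = Min (cycle_of n L ?r)] (mod L)"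
    by (auto simp: mem_cycle_of_iff)
  from path_trans[OF ir this] show ?thesis
    using min(2) by (auto simp: path_connected_to_def)
qed

text \<open>
  There is only one walk out of \<open>i\<close>, so the minimum that is reached later is reached from the
  other one and lies on the same cycle.
\<close>

lemma cycle_minimum_unique:
  assumes "r \<in> cycle_minima n L" "r' \<in> cycle_minima n L"
    and "path_connected_to n L i r" "path_connected_to n L i r'"
  shows "r = r'"
proof -
  have *: "r = r'" if "r \<in> cycle_minima n L" "r' \<in> cycle_minima n L" "s \<le> t"
    "[n ^ s * i = r] (mod L)" "[n ^ t * i = r'] (mod L)" for r r' s t
  proof -
    have "[n ^ (s + (t - s)) * i = r'] (mod L)"
      using that by simp
    from path_cancel[OF that(4) this] have "r' \<in> cycle_of n L r"
      using that by (auto simp: mem_cycle_of_iff cycle_minima_def is_root_iff)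
    then have "cycle_of n L r' = cycle_of n L r"
      using that root_in_cycle by (simp add: cycle_minima_def)
    then show ?thesis
      using that by (simp add: cycle_minima_def)
  qed
  from assms(3,4) obtain s t where "[n ^ s * i = r] (mod L)" "[n ^ t * i = r'] (mod L)"
    by (auto simp: path_connected_to_def)
  then show ?thesis
    using *[of r r' s t] *[of r' r t s] assms by (cases "s \<le> t") auto
qed


section \<open>The coefficient sequences of the basis functions\<close>

lemma path_dist_path:
  "path_connected_to n L i r \<Longrightarrow> [n ^ path_dist n L i r * i = r] (mod L)"
  unfolding path_connected_to_def path_dist_def by (rule LeastI_ex)

lemma path_dist_least: "[n ^ k * i = r] (mod L) \<Longrightarrow> path_dist n L i r \<le> k"
  unfolding path_dist_def by (rule Least_le)

lemma path_dist_self [simp]: "path_dist n L r r = 0"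
  using path_dist_least[of n 0 r r L] by simp

text \<open>
  A root is never left for good: if \<open>i\<close> is already in the
  class of \<open>r\<close>, its successor gets back to \<open>r\<close> by going around the cycle.
\<close>

lemma path_connected_step:
  assumes "is_root n L r"
  shows "path_connected_to n L (n * i) r \<longleftrightarrow> path_connected_to n L i r"
proof
  assume "path_connected_to n L (n * i) r"
  then obtain k where "[n ^ k * (n * i) = r] (mod L)"
    by (auto simp: path_connected_to_def)
  then have "[n ^ Suc k * i = r] (mod L)"
    by (simp add: mult_ac)
  then show "path_connected_to n L i r"
    unfolding path_connected_to_def by blast
next
  assume "path_connected_to n L i r"
  then obtain k where k: "[n ^ k * i = r] (mod L)"
    by (auto simp: path_connected_to_def)
  obtain l where l: "l \<ge> 1" "[n ^ l * r = r] (mod L)"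
    using assms by (auto simp: is_root_iff)
  have "[n ^ (l - 1 + k) * (n * i) = r] (mod L)"
    using path_trans[OF k l(2)] l(1) by (cases l) (simp_all add: mult_ac)
  then show "path_connected_to n L (n * i) r"
    unfolding path_connected_to_def by blast
qed

lemma path_dist_step:
  assumes "path_connected_to n L i r" and "path_dist n L i r > 0"
  shows "path_dist n L i r = Suc (path_dist n L (n * i) r)"
proof (rule antisym)
  let ?d = "path_dist n L i r"
  have "[n ^ (?d - 1) * (n * i) = r] (mod L)"
    using path_dist_path[OF assms(1)] assms(2) by (cases ?d) (simp_all add: mult_ac)
  then show "Suc (path_dist n L (n * i) r) \<le> ?d"
    using path_dist_least[of n "?d - 1" "n * i" r L] assms(2) by simp
  have "path_connected_to n L (n * i) r"
    using \<open>[n ^ (?d - 1) * (n * i) = r] (mod L)\<close> by (auto simp: path_connected_to_def)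
  from path_dist_path[OF this] have "[n ^ Suc (path_dist n L (n * i) r) * i = r] (mod L)"
    by (simp add: mult_ac)
  then show "?d \<le> Suc (path_dist n L (n * i) r)"
    by (rule path_dist_least)
qed

lemma primitive_root_power_eq_1_iff:
  assumes "primitive_root_of_unity m \<omega>"
  shows "\<omega> ^ k = 1 \<longleftrightarrow> m dvd k"
proof
  have m: "m \<ge> 1" "\<omega> ^ m = 1" and min: "\<And>j. 1 \<le> j \<Longrightarrow> j < m \<Longrightarrow> \<omega> ^ j \<noteq> 1"
    using assms by (auto simp: primitive_root_of_unity_def)
  {
    assume "\<omega> ^ k = 1"
    moreover have "\<omega> ^ k = (\<omega> ^ m) ^ (k div m) * \<omega> ^ (k mod m)"
      by (simp flip: power_mult power_add)
    ultimately have "\<omega> ^ (k mod m) = 1"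
      using m by simp
    then have "k mod m = 0"
      using min[of "k mod m"] m(1) by (cases "k mod m = 0") auto
    then show "m dvd k"
      by auto
  next
    assume "m dvd k"
    then show "\<omega> ^ k = 1"
      using m(2) by (auto simp: power_mult)
  }
qed

lemma primitive_root_nonzero: "primitive_root_of_unity m \<omega> \<Longrightarrow> \<omega> \<noteq> 0"
  by (auto simp: primitive_root_of_unity_def power_0_left)

lemma a_coeff_connected:
  "path_connected_to n L i r \<Longrightarrow> a_coeff \<omega> L n r i = inverse (\<omega> ^ path_dist n L i r)"
  by (simp add: a_coeff_def power_int_minus)

text \<open>
  Along the edge from \<open>i\<close> to \<open>n i\<close> the distance to \<open>r\<close> decreases by one unless \<open>i\<close> is in the
  class of \<open>r\<close>. In that case it becomes \<open>l - 1\<close> for the cycle length \<open>l\<close>, and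
  \<open>\<omega>\<^sup>-\<^sup>(\<^sup>l\<^sup>-\<^sup>1\<^sup>) = \<omega>\<close> because \<open>m\<close> divides \<open>l\<close>.
\<close>

lemma a_coeff_in_eigen_seqs:
  assumes \<omega>: "primitive_root_of_unity m \<omega>"
    and root: "is_root n L r" and "m dvd card (cycle_of n L r)"
  shows "a_coeff \<omega> L n r \<in> eigen_seqs n \<omega> L"
proof -
  have nz: "\<omega> \<noteq> 0"
    using \<omega> by (rule primitive_root_nonzero)
  have shift: "[n ^ t * (k + L) = r] (mod L) \<longleftrightarrow> [n ^ t * k = r] (mod L)" for t k
    by (simp add: cong_def distrib_left)
  have "a_coeff \<omega> L n r (k + L) = a_coeff \<omega> L n r k" for k
    by (simp add: a_coeff_def path_connected_to_def path_dist_def shift)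
  moreover have "a_coeff \<omega> L n r (n * i) = \<omega> * a_coeff \<omega> L n r i" for i
  proof (cases "path_connected_to n L i r")
    case False
    then show ?thesis
      using path_connected_step[OF root, of i] by (simp add: a_coeff_def)
  next
    case True
    then have True': "path_connected_to n L (n * i) r"
      using path_connected_step[OF root] by simp
    let ?e = "path_dist n L (n * i) r" and ?l = "card (cycle_of n L r)"
    show ?thesis
    proof (cases "path_dist n L i r = 0")
      case False
      then have "path_dist n L i r = Suc ?e"
        using path_dist_step[OF True] by simp
      then show ?thesis
        unfolding a_coeff_connected[OF True] a_coeff_connected[OF True'] using nz by simp
    next
      case d0: True
      then have ir: "[n ^ 0 * i = r] (mod L)"
        using path_dist_path[OF True] by simp
      have "[n ^ (0 + Suc ?e) * i = r] (mod L)"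
        using path_dist_path[OF True'] by (simp add: mult_ac)
      from path_cancel[OF ir this] have "?l \<le> Suc ?e"
        using card_cycle_return_time(3)[OF root] by simp
      moreover have "[n ^ (?l - 1) * (n * i) = r] (mod L)"
        using path_trans[OF ir card_cycle_return_time(2)[OF root]] card_cycle_return_time(1)[OF root]
        by (cases ?l) (simp_all add: mult_ac)
      then have "?e \<le> ?l - 1"
        by (rule path_dist_least)
      ultimately have "Suc ?e = ?l"
        using card_cycle_return_time(1)[OF root] by simp
      then have "\<omega> ^ Suc ?e = 1"
        using assms(3) primitive_root_power_eq_1_iff[OF \<omega>] by simp
      then have "inverse (\<omega> ^ ?e) = \<omega>"
        using nz by (simp add: field_simps)
      then show ?thesis
        unfolding a_coeff_connected[OF True] a_coeff_connected[OF True'] d0 by simp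
    qed
  qed
  ultimately show ?thesis
    by (simp add: eigen_seqs_def)
qed

lemma a_coeff_at_minima:
  assumes "r \<in> cycle_minima n L" "r' \<in> cycle_minima n L"
  shows "a_coeff \<omega> L n r r' = (if r' = r then 1 else 0)"
proof -
  have refl: "path_connected_to n L r' r'"
    unfolding path_connected_to_def by (rule exI[of _ 0]) simp
  then have "path_connected_to n L r' r \<longleftrightarrow> r' = r"
    using cycle_minimum_unique[OF assms(2,1)] by auto
  then show ?thesis
    by (simp add: a_coeff_def)
qed

text \<open>
  Only the term of the cycle minimum \<open>s\<close> that \<open>i\<close> leads to can contribute. It is missing from
  the sum if \<open>m\<close> does not divide the length of the cycle of \<open>s\<close>; going around that cycle once
  multiplies \<open>a s\<close> by a power of \<open>\<omega>\<close> other than \<open>1\<close>, so then \<open>a s = 0\<close>.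
\<close>

lemma eigen_seq_expansion:
  assumes "L \<ge> 1" and \<omega>: "primitive_root_of_unity m \<omega>" and a: "a \<in> eigen_seqs n \<omega> L"
  shows "a i = (\<Sum>r\<in>Min ` B_cycles m n L. a r * a_coeff \<omega> L n r i)"
proof -
  let ?R = "Min ` B_cycles m n L"
  have fin: "finite ?R"
    unfolding Min_B_cycles
    by (rule finite_subset[of _ "{..<L}"]) (auto simp: cycle_minima_def is_root_iff)
  obtain s where s: "s \<in> cycle_minima n L" and conn: "path_connected_to n L i s"
    using path_to_cycle_minimum[OF \<open>L \<ge> 1\<close>] by blast
  have root: "is_root n L s"
    using s by (simp add: cycle_minima_def)
  have nz: "\<omega> \<noteq> 0"
    using \<omega> by (rule primitive_root_nonzero)
  have "a s = \<omega> ^ path_dist n L i s * a i"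
    using eigen_seq_along_path[OF a path_dist_path[OF conn]] .
  then have ai: "a i = a s * a_coeff \<omega> L n s i"
    using nz by (simp add: a_coeff_connected[OF conn])
  have "a r * a_coeff \<omega> L n r i = (if r = s then a s * a_coeff \<omega> L n s i else 0)" if "r \<in> ?R" for r
  proof -
    have "r \<in> cycle_minima n L"
      using that by (simp add: Min_B_cycles)
    then have "\<not> path_connected_to n L i r" if "r \<noteq> s"
      using cycle_minimum_unique[OF _ s _ conn] that by blast
    then show ?thesis
      by (cases "r = s") (simp_all add: a_coeff_def)
  qed
  then have "(\<Sum>r\<in>?R. a r * a_coeff \<omega> L n r i) = (if s \<in> ?R then a s * a_coeff \<omega> L n s i else 0)"
    using fin by (simp add: sum.delta)
  moreover have "a s = 0" if "s \<notin> ?R"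
  proof -
    have "\<omega> ^ card (cycle_of n L s) \<noteq> 1"
      using that s by (simp add: Min_B_cycles primitive_root_power_eq_1_iff[OF \<omega>])
    moreover have "a s = \<omega> ^ card (cycle_of n L s) * a s"
      using eigen_seq_along_path[OF a card_cycle_return_time(2)[OF root]] .
    ultimately show ?thesis
      by (metis mult_cancel_right2)
  qed
  ultimately show ?thesis
    using ai by auto
qed


section \<open>The basis\<close>

lemma F_fun_eq: "F_fun \<omega> L \<kappa> n r = weighted_series \<kappa> (a_coeff \<omega> L n r)"
  by (simp add: F_fun_def weighted_series_def)

text \<open>
  The coefficient of \<open>F_fun\<close> at index \<open>r + L\<close> separates the cycle minimum \<open>r\<close> from all others.
  The index \<open>r\<close> itself would not do: for \<open>r = 0\<close> and \<open>\<kappa> > 1\<close> the weight \<open>r\<^sup>\<kappa>\<^sup>-\<^sup>1\<close> vanishes.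
\<close>

lemma independent_F_fun:
  assumes "L \<ge> 1" and \<omega>: "primitive_root_of_unity m \<omega>"
  shows "fps_vs.independent (F_fun \<omega> L \<kappa> n ` Min ` B_cycles m n L)" (is "fps_vs.independent (_ ` ?R)")
proof (rule fps_vs.independent_if_scalars_zero)
  have sub: "?R \<subseteq> {..<L}"
    unfolding Min_B_cycles by (auto simp: cycle_minima_def is_root_iff)
  then show fin: "finite (F_fun \<omega> L \<kappa> n ` ?R)"
    using finite_subset by blast
  fix c v
  assume zero: "(\<Sum>g\<in>F_fun \<omega> L \<kappa> n ` ?R. fps_const (c g) * g) = 0"
    and "v \<in> F_fun \<omega> L \<kappa> n ` ?R"
  then obtain r where r: "r \<in> ?R" and v: "v = F_fun \<omega> L \<kappa> n r"
    by blast
  have coeff: "fps_nth (F_fun \<omega> L \<kappa> n r') (r + L) = of_nat (r + L) ^ (\<kappa> - 1) * (if r' = r then 1 else 0)"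
    if "r' \<in> ?R" for r'
  proof -
    have "a_coeff \<omega> L n r' \<in> eigen_seqs n \<omega> L"
      using that by (intro a_coeff_in_eigen_seqs[OF \<omega>]) (auto simp: Min_B_cycles cycle_minima_def)
    then have "a_coeff \<omega> L n r' (r + L) = a_coeff \<omega> L n r' r"
      by (simp add: eigen_seqs_def)
    then show ?thesis
      using a_coeff_at_minima[of r' n L r \<omega>] that r by (auto simp: F_fun_eq Min_B_cycles)
  qed
  have "0 = fps_nth (\<Sum>g\<in>F_fun \<omega> L \<kappa> n ` ?R. fps_const (c g) * g) (r + L)"
    by (simp add: zero)
  also have "\<dots> = (\<Sum>g\<in>F_fun \<omega> L \<kappa> n ` ?R. c g * fps_nth g (r + L))"
    by (simp add: fps_sum_nth)
  also have "\<dots> = (\<Sum>g\<in>F_fun \<omega> L \<kappa> n ` ?R. if g = v then c v * of_nat (r + L) ^ (\<kappa> - 1) else 0)"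
  proof (rule sum.cong[OF refl])
    fix g assume "g \<in> F_fun \<omega> L \<kappa> n ` ?R"
    then obtain r' where r': "r' \<in> ?R" "g = F_fun \<omega> L \<kappa> n r'"
      by blast
    show "c g * fps_nth g (r + L) = (if g = v then c v * of_nat (r + L) ^ (\<kappa> - 1) else 0)"
    proof (cases "g = v")
      case True
      then show ?thesis
        using coeff[OF r] v by simp
    next
      case False
      then have "r' \<noteq> r"
        using r' v by auto
      then show ?thesis
        using coeff[OF r'(1)] r' False by simp
    qed
  qed
  also have "\<dots> = c v * of_nat (r + L) ^ (\<kappa> - 1)"
    using fin \<open>v \<in> _\<close> by (simp add: sum.delta)
  finally show "c v = 0"
    using assms(1) by (simp del: of_nat_add)
qed

theorem theorem11:
  fixes n L \<kappa> m :: nat and \<omega> :: complex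
  assumes "n \<ge> 1" and "L \<ge> 1" and "\<kappa> \<ge> 1"
    and "primitive_root_of_unity m \<omega>"
  shows "basis_of (\<Union>A\<in>B_cycles m n L. {F_fun \<omega> L \<kappa> n r | r. r = Min A}) (E_space n \<omega> L \<kappa>)"
proof -
  let ?R = "Min ` B_cycles m n L" and ?E = "E_space n \<omega> L \<kappa>"
  let ?B = "F_fun \<omega> L \<kappa> n ` ?R"
  have "F_fun \<omega> L \<kappa> n r \<in> ?E" if "r \<in> ?R" for r
    using that a_coeff_in_eigen_seqs[OF assms(4)]
    by (auto simp: E_space_eq[OF assms(1,2)] F_fun_eq Min_B_cycles cycle_minima_def)
  then have sub: "?B \<subseteq> ?E"
    by blast
  have "f \<in> fps_vs.span ?B" if f: "f \<in> ?E" for f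
  proof -
    obtain a where a: "a \<in> eigen_seqs n \<omega> L" and fa: "f = weighted_series \<kappa> a"
      using f E_space_eq[OF assms(1,2)] by auto
    have "f = (\<Sum>r\<in>?R. fps_const (a r) * F_fun \<omega> L \<kappa> n r)"
    proof (rule fps_ext)
      fix k
      show "fps_nth f k = fps_nth (\<Sum>r\<in>?R. fps_const (a r) * F_fun \<omega> L \<kappa> n r) k"
        unfolding fa weighted_series_nth eigen_seq_expansion[OF assms(2,4) a, of k]
        by (simp add: fps_sum_nth F_fun_eq sum_distrib_left mult_ac)
    qed
    also have "\<dots> \<in> fps_vs.span ?B"
      by (intro fps_vs.span_sum fps_vs.span_scale fps_vs.span_base imageI)
    finally show ?thesis .
  qed
  then have "fps_vs.span ?B = ?E"
    using fps_vs.span_minimal[OF sub subspace_E_space[OF assms(1,2)]] by blast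
  moreover have "(\<Union>A\<in>B_cycles m n L. {F_fun \<omega> L \<kappa> n r | r. r = Min A}) = ?B"
    by auto
  ultimately show ?thesis
    unfolding basis_of_def
    using sub subspace_E_space[OF assms(1,2)] independent_F_fun[OF assms(2,4)] by simp
qed

end
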